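(* Let $n\geq 0$, let $NC^B(n)$ be the set of type $B$ noncrossing partitions of $[n]$, and let $A_n\subseteq NC^B(n)$ be the set of those partitions that have no zero block and in which every nonzero block has exactly two elements. There is an involution $\rho$ on $NC^B(n)\setminus A_n$ (i.e. a map with $\rho\circ\rho=\mathrm{id}$) such that for every $\pi\in NC^B(n)\setminus A_n$ the numbers of pairs of nonzero blocks of $\pi$ and of $\rho(\pi)$ have opposite parity.
   Context: A type $B$ partition of $[n]=\{1,\dots,n\}$ is a set partition $\pi$ of $\{1,\dots,n,-1,\dots,-n\}$ such that for every block $B$ of $\pi$ the set $-B=\{-b: b\in B\}$ is also a block of $\pi$, and at most one block (called the zero block) satisfies $B=-B$. The blocks other than the zero block are called nonzero blocks; they come in pairs $\{B,-B\}$ with $B\neq -B$. Order the elements as $1<2<\cdots<n<-1<-2<\cdots<-n$. The type $B$ partition $\pi$ is noncrossing if there are no elements $a<b<c<d$ (in this order) with $a,c$ in one block and $b,d$ in a different block. *)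

theory Defs
  imports Main "HOL-Library.Disjoint_Sets"
begin

definition signed_set :: "nat \<Rightarrow> int set" where
  "signed_set n = {1..int n} \<union> {- int n..-1}"

abbreviation neg_block :: "int set \<Rightarrow> int set" where
  "neg_block B \<equiv> uminus ` B"

definition type_B_partition :: "nat \<Rightarrow> int set set \<Rightarrow> bool" where
  "type_B_partition n \<pi> \<longleftrightarrow>
     partition_on (signed_set n) \<pi> \<and>
     (\<forall>B\<in>\<pi>. neg_block B \<in> \<pi>) \<and>
     (\<forall>B\<in>\<pi>. \<forall>C\<in>\<pi>. neg_block B = B \<longrightarrow> neg_block C = C \<longrightarrow> B = C)"

definition zero_blocks :: "int set set \<Rightarrow> int set set" where
  "zero_blocks \<pi> = {B \<in> \<pi>. neg_block B = B}"

definition nonzero_blocks :: "int set set \<Rightarrow> int set set" where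
  "nonzero_blocks \<pi> = {B \<in> \<pi>. neg_block B \<noteq> B}"

definition nonzero_block_pairs :: "int set set \<Rightarrow> int set set set" where
  "nonzero_block_pairs \<pi> = (\<lambda>B. {B, neg_block B}) ` nonzero_blocks \<pi>"

text \<open>The order \<open>1 < 2 < \<dots> < n < -1 < -2 < \<dots> < -n\<close> on nonzero integers,
  which is not the usual order on the negative ones.\<close>

definition signed_less :: "int \<Rightarrow> int \<Rightarrow> bool" where
  "signed_less a b \<longleftrightarrow> (0 < a \<and> a < b) \<or> (0 < a \<and> b < 0) \<or> (b < a \<and> a < 0)"

definition noncrossing :: "int set set \<Rightarrow> bool" where
  "noncrossing \<pi> \<longleftrightarrow>
     \<not> (\<exists>B\<in>\<pi>. \<exists>C\<in>\<pi>. B \<noteq> C \<and>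
         (\<exists>a b c d. signed_less a b \<and> signed_less b c \<and> signed_less c d \<and>
            a \<in> B \<and> c \<in> B \<and> b \<in> C \<and> d \<in> C))"

definition NC_B :: "nat \<Rightarrow> int set set set" where
  "NC_B n = {\<pi>. type_B_partition n \<pi> \<and> noncrossing \<pi>}"

definition A_B :: "nat \<Rightarrow> int set set set" where
  "A_B n = {\<pi> \<in> NC_B n. zero_blocks \<pi> = {} \<and> (\<forall>B\<in>nonzero_blocks \<pi>. card B = 2)}"

end

theory Submission
  imports Defs
begin

text \<open>
  Place \<open>1, \<dots>, n, -1, \<dots>, -n\<close> on a circle, so that negation is the antipodal map. Call \<open>i\<close>
  inner if it lies in the zero block, or if its block contains elements strictly inside both of
  the open half circles bounded by \<open>i\<close> and \<open>-i\<close>; in a nonzero block this means that \<open>i\<close> is neither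
  the first nor the last element. Splitting off \<open>{i}\<close> and \<open>{-i}\<close> is a bijection from the partitions
  in which \<open>i\<close> is inner onto those in which \<open>{i}\<close> is a block: for the inverse, \<open>i\<close> joins the innermost
  block which spans it, or \<open>-i\<close> if there is none. It adds one pair of nonzero blocks, and it does not
  change which other elements are inner or singletons. The involution toggles in this way the
  least positive \<open>i\<close> which is inner or a singleton. There is no such \<open>i\<close> exactly when each element is
  either the first or the last one of a nonzero block and not both, that is, on the set
  \<open>A_B n\<close>.
\<close>

section \<open>Positions on the circle\<close>

definition pos :: "nat \<Rightarrow> int \<Rightarrow> int" where
  "pos n x = (if 0 < x then x else int n - x)"

definition crossfree :: "(int \<Rightarrow> int \<Rightarrow> bool) \<Rightarrow> (int \<Rightarrow> int) \<Rightarrow> bool" where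
  "crossfree e k \<longleftrightarrow> (\<forall>a b c d. k a < k b \<and> k b < k c \<and> k c < k d \<and> e a c \<and> e b d \<longrightarrow> e a b)"

text \<open>Making \<open>e\<close> false outside \<open>signed_set n\<close> lets relations
  correspond one to one to partitions, so that two of them can be compared with plain
  \<open>=\<close>.\<close>

definition equiv_rel :: "nat \<Rightarrow> (int \<Rightarrow> int \<Rightarrow> bool) \<Rightarrow> bool" where
  "equiv_rel n e \<longleftrightarrow> (\<forall>x y. e x y \<longrightarrow> x \<in> signed_set n) \<and> (\<forall>x\<in>signed_set n. e x x) \<and>
     (\<forall>x y. e x y \<longrightarrow> e y x) \<and> (\<forall>x y z. e x y \<longrightarrow> e y z \<longrightarrow> e x z)"

text \<open>At most one zero block is not required: it follows from the noncrossing condition,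
  see \<open>nc_rel_zero\<close>.\<close>

definition nc_rel :: "nat \<Rightarrow> (int \<Rightarrow> int \<Rightarrow> bool) \<Rightarrow> bool" where
  "nc_rel n e \<longleftrightarrow> equiv_rel n e \<and> (\<forall>x y. e x y \<longrightarrow> e (- x) (- y)) \<and> crossfree e (pos n)"

text \<open>\<open>y\<close> lies on the open half circle that leads from \<open>x\<close> to \<open>-x\<close>.\<close>

definition precedes :: "nat \<Rightarrow> int \<Rightarrow> int \<Rightarrow> bool" where
  "precedes n x y \<longleftrightarrow> (pos n x < pos n y \<and> pos n y < pos n x + int n) \<or> pos n y + int n < pos n x"

text \<open>The position after opening the circle at \<open>-i\<close>, which gets position \<open>0\<close>, so that \<open>i\<close> is
  in the middle, at position \<open>n\<close>.\<close>

definition cutpos :: "nat \<Rightarrow> int \<Rightarrow> int \<Rightarrow> int" where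
  "cutpos n i x = (if pos n (- i) \<le> pos n x then pos n x - pos n (- i)
                else pos n x - pos n (- i) + 2 * int n)"

definition single :: "(int \<Rightarrow> int \<Rightarrow> bool) \<Rightarrow> int \<Rightarrow> bool" where
  "single e i \<longleftrightarrow> (\<forall>x. e i x \<longrightarrow> x = i)"

definition inner :: "nat \<Rightarrow> (int \<Rightarrow> int \<Rightarrow> bool) \<Rightarrow> int \<Rightarrow> bool" where
  "inner n e i \<longleftrightarrow> e i (- i) \<or> (\<exists>a b. e i a \<and> e i b \<and> precedes n a i \<and> precedes n i b)"

definition isolate :: "int \<Rightarrow> (int \<Rightarrow> int \<Rightarrow> bool) \<Rightarrow> int \<Rightarrow> int \<Rightarrow> bool" where
  "isolate i e x y \<longleftrightarrow> e x y \<and> (x = y \<or> (x \<notin> {i, - i} \<and> y \<notin> {i, - i}))"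

lemma signed_set_iff: "x \<in> signed_set n \<longleftrightarrow> x \<noteq> 0 \<and> \<bar>x\<bar> \<le> int n"
  by (auto simp: signed_set_def)

lemma signed_set_uminus [simp]: "- x \<in> signed_set n \<longleftrightarrow> x \<in> signed_set n"
  by (auto simp: signed_set_iff)

lemma equiv_relD:
  assumes "equiv_rel n e"
  shows "e x y \<Longrightarrow> x \<in> signed_set n" "e x y \<Longrightarrow> y \<in> signed_set n"
    "x \<in> signed_set n \<Longrightarrow> e x x" "e x y \<Longrightarrow> e y x" "e x y \<Longrightarrow> e y z \<Longrightarrow> e x z"
  using assms unfolding equiv_rel_def by blast+

lemma nc_relD:
  assumes "nc_rel n e"
  shows "e x y \<Longrightarrow> x \<in> signed_set n" "e x y \<Longrightarrow> y \<in> signed_set n"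
    "x \<in> signed_set n \<Longrightarrow> e x x" "e x y \<Longrightarrow> e y x" "e x y \<Longrightarrow> e y z \<Longrightarrow> e x z"
    "e x y \<Longrightarrow> e (- x) (- y)" "equiv_rel n e" "crossfree e (pos n)"
  using assms unfolding nc_rel_def equiv_rel_def by blast+

section \<open>Crossings and half circles under rotations of the circle\<close>

lemma crossfreeD:
  "crossfree e k \<Longrightarrow> k a < k b \<Longrightarrow> k b < k c \<Longrightarrow> k c < k d \<Longrightarrow> e a c \<Longrightarrow> e b d \<Longrightarrow> e a b"
  unfolding crossfree_def by blast

text \<open>Whether two chords cross depends only on the cyclic order of their ends. The hypothesis
  on \<open>v\<close> says that the order by \<open>u\<close> is cut at \<open>s\<close> and the
  piece from \<open>s\<close> on is moved to the front.\<close>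

lemma crossfree_rotate:
  fixes u v :: "int \<Rightarrow> int"
  assumes e: "equiv_rel n e"
    and uv: "\<And>x y. x \<in> signed_set n \<Longrightarrow> y \<in> signed_set n \<Longrightarrow>
      v x < v y \<longleftrightarrow> (if (u x < s) = (u y < s) then u x < u y else u y < s)"
    and cf: "crossfree e u"
  shows "crossfree e v"
  unfolding crossfree_def
proof (intro allI impI, elim conjE)
  fix a b c d
  assume lt: "v a < v b" "v b < v c" "v c < v d" and ac: "e a c" and bd: "e b d"
  have S: "a \<in> signed_set n" "b \<in> signed_set n" "c \<in> signed_set n" "d \<in> signed_set n"
    using equiv_relD[OF e] ac bd by blast+
  \<comment> \<open>One of the four cyclic shifts, according to how many of the four elements lie at
    or above \<open>s\<close>.\<close>
  have "u a < u b \<and> u b < u c \<and> u c < u d \<or> u d < u a \<and> u a < u b \<and> u b < u c \<or>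
      u c < u d \<and> u d < u a \<and> u a < u b \<or> u b < u c \<and> u c < u d \<and> u d < u a"
    using lt uv[OF S(1,2)] uv[OF S(2,3)] uv[OF S(3,4)] by (simp split: if_splits; linarith)
  then show "e a b"
  proof (elim disjE conjE)
    assume "u a < u b" "u b < u c" "u c < u d"
    then show ?thesis using crossfreeD[OF cf] ac bd by blast
  next
    assume "u d < u a" "u a < u b" "u b < u c"
    then show ?thesis using crossfreeD[OF cf _ _ _ equiv_relD(4)[OF e bd] ac] equiv_relD(4,5)[OF e] bd by blast
  next
    assume "u c < u d" "u d < u a" "u a < u b"
    then have "e c d"
      using crossfreeD[OF cf _ _ _ equiv_relD(4)[OF e ac] equiv_relD(4)[OF e bd]] by blast
    then show ?thesis using ac bd equiv_relD(4,5)[OF e] by blast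
  next
    assume "u b < u c" "u c < u d" "u d < u a"
    then have "e b c" using crossfreeD[OF cf _ _ _ bd equiv_relD(4)[OF e ac]] by blast
    then show ?thesis using ac equiv_relD(4,5)[OF e] by blast
  qed
qed

lemma cutpos_zero: "cutpos n i (- i) = 0"
  by (simp add: cutpos_def)

text \<open>Opening the circle elsewhere shifts positions modulo \<open>2 * n\<close>. Negation
  remains a shift by \<open>n\<close>, and \<open>precedes\<close> says that the way from
  \<open>x\<close> to \<open>y\<close> in the direction of increasing positions has length strictly
  between \<open>0\<close> and \<open>n\<close>, so it takes the same form for every cut.\<close>

lemma cutpos_props:
  assumes "i \<in> signed_set n"
  shows "cutpos n i i = int n"
    and "x \<in> signed_set n \<Longrightarrow> 0 \<le> cutpos n i x \<and> cutpos n i x < 2 * int n"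
    and "x \<in> signed_set n \<Longrightarrow>
      cutpos n i (- x) = (if cutpos n i x < int n then cutpos n i x + int n else cutpos n i x - int n)"
    and "x \<in> signed_set n \<Longrightarrow> y \<in> signed_set n \<Longrightarrow> cutpos n i x = cutpos n i y \<longleftrightarrow> x = y"
    and "x \<in> signed_set n \<Longrightarrow> y \<in> signed_set n \<Longrightarrow> precedes n x y \<longleftrightarrow>
      (cutpos n i x < cutpos n i y \<and> cutpos n i y < cutpos n i x + int n) \<or> cutpos n i y + int n < cutpos n i x"
  using assms unfolding cutpos_def pos_def precedes_def signed_set_iff by (auto split: if_splits)

lemma precedes_from:
  assumes "i \<in> signed_set n" "x \<in> signed_set n"
  shows "precedes n i x \<longleftrightarrow> int n < cutpos n i x"
    and "precedes n x i \<longleftrightarrow> 0 < cutpos n i x \<and> cutpos n i x < int n"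
  using cutpos_props(1)[OF assms(1)] cutpos_props(2)[OF assms] cutpos_props(5)[OF assms(1) assms(1) assms(2)]
     cutpos_props(5)[OF assms(1) assms(2) assms(1)] by auto

lemma crossfree_cut:
  assumes e: "equiv_rel n e" and i: "i \<in> signed_set n"
  shows "crossfree e (cutpos n i) \<longleftrightarrow> crossfree e (pos n)"
proof
  assume "crossfree e (pos n)"
  then show "crossfree e (cutpos n i)"
    by (rule crossfree_rotate[OF e, where s = "pos n (- i)", rotated])
      (use i in \<open>auto simp: cutpos_def pos_def signed_set_iff split: if_splits\<close>)
next
  assume "crossfree e (cutpos n i)"
  \<comment> \<open>If \<open>-i\<close> is not \<open>1\<close>, this \<open>s\<close> is the cut
    position of \<open>1\<close>, where the original order starts. If \<open>-i\<close> is
    \<open>1\<close>, it is \<open>2 * n\<close>, above all cut positions, and nothing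
    moves.\<close>
  then show "crossfree e (pos n)"
    by (rule crossfree_rotate[OF e, where s = "2 * int n + 1 - pos n (- i)", rotated])
      (use i in \<open>auto simp: cutpos_def pos_def signed_set_iff split: if_splits\<close>)
qed

lemma precedes_neq: "precedes n x y \<Longrightarrow> x \<noteq> y"
  unfolding precedes_def by auto

lemma precedes_neq_uminus: "precedes n x y \<Longrightarrow> x \<noteq> - y"
  unfolding precedes_def pos_def by (auto split: if_splits)

lemma precedes_uminus:
  assumes "x \<in> signed_set n" "y \<in> signed_set n"
  shows "precedes n (- x) y \<longleftrightarrow> precedes n y x" "precedes n x (- y) \<longleftrightarrow> precedes n y x"
  using assms unfolding precedes_def pos_def signed_set_iff by (auto split: if_splits)

lemma precedes_total:
  assumes "x \<in> signed_set n" "y \<in> signed_set n" "x \<noteq> y" "x \<noteq> - y"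
  shows "precedes n x y \<or> precedes n y x"
  using assms unfolding precedes_def pos_def signed_set_iff by (auto split: if_splits)

lemma nc_rel_cut: "nc_rel n e \<Longrightarrow> i \<in> signed_set n \<Longrightarrow> crossfree e (cutpos n i)"
  using crossfree_cut nc_relD(7,8) by blast

text \<open>Two distinct diameters of the circle cross, so their ends belong to one block. Opening
  the circle at \<open>-x\<close> makes the crossing visible: one of \<open>y\<close>,
  \<open>-y\<close> lies before \<open>x\<close> and the other after it.\<close>

lemma nc_rel_zero:
  assumes nc: "nc_rel n e" and x: "e x (- x)" and y: "e y (- y)"
  shows "e x y"
proof -
  have S: "x \<in> signed_set n" "y \<in> signed_set n" using nc_relD(1)[OF nc] x y by blast+
  consider "x = y" | "x = - y" | "precedes n y x" | "precedes n x y"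
    using precedes_total[OF S] by blast
  then show ?thesis
  proof cases
    case 1 then show ?thesis using S nc_relD(3)[OF nc] by blast
  next
    case 2 then show ?thesis using x nc_relD(4)[OF nc] y by force
  next
    case 3
    then have "cutpos n x (- x) < cutpos n x y" "cutpos n x y < cutpos n x x" "cutpos n x x < cutpos n x (- y)"
      using precedes_from(2)[OF S] cutpos_props(1,3)[OF S(1)] S cutpos_zero by auto
    then show ?thesis
      using nc_relD(5)[OF nc x crossfreeD[OF nc_rel_cut[OF nc S(1)] _ _ _ nc_relD(4)[OF nc x] y]] by blast
  next
    case 4
    then have *: "int n < cutpos n x y" using precedes_from(1)[OF S] by blast
    then have "cutpos n x (- x) < cutpos n x (- y)" "cutpos n x (- y) < cutpos n x x" "cutpos n x x < cutpos n x y"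
      using cutpos_props(1,3)[OF S(1)] cutpos_props(2)[OF S] S cutpos_zero by auto
    then show ?thesis
      using nc_relD(5)[OF nc nc_relD(5)[OF nc x crossfreeD[OF nc_rel_cut[OF nc S(1)] _ _ _
        nc_relD(4)[OF nc x] nc_relD(4)[OF nc y]]] nc_relD(4)[OF nc y]] by blast
  qed
qed

lemma inner_uminus:
  assumes nc: "nc_rel n e" and "inner n e i"
  shows "inner n e (- i)"
proof -
  consider "e i (- i)" | a b where "e i a" "e i b" "precedes n a i" "precedes n i b"
    using assms(2) unfolding inner_def by blast
  then show ?thesis
  proof cases
    case 1 then show ?thesis using nc_relD(6)[OF nc] unfolding inner_def by blast
  next
    case 2
    then have "e (- i) (- a)" "e (- i) (- b)" "precedes n (- a) (- i)" "precedes n (- i) (- b)"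
      using nc_relD(1,2,6)[OF nc] precedes_uminus by simp_all
    then show ?thesis unfolding inner_def by blast
  qed
qed

text \<open>Isolating creates no crossing: the chords of a crossing join distinct elements, and such
  chords of \<open>isolate i e\<close> are chords of \<open>e\<close> that avoid \<open>i\<close>
  and \<open>-i\<close>.\<close>

lemma isolate_nc_rel:
  assumes "nc_rel n e"
  shows "nc_rel n (isolate i e)"
  unfolding nc_rel_def
proof (intro conjI)
  show "equiv_rel n (isolate i e)"
    using nc_relD[OF assms] unfolding equiv_rel_def isolate_def by (smt (verit))
  show "\<forall>x y. isolate i e x y \<longrightarrow> isolate i e (- x) (- y)"
    using nc_relD(6)[OF assms] unfolding isolate_def by auto
  show "crossfree (isolate i e) (pos n)"
    unfolding crossfree_def
  proof (intro allI impI, elim conjE)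
    fix a b c d
    assume lt: "pos n a < pos n b" "pos n b < pos n c" "pos n c < pos n d"
      and ac: "isolate i e a c" and bd: "isolate i e b d"
    have "a \<noteq> c" "b \<noteq> d" using lt by auto
    then have "e a c" "e b d" "a \<notin> {i, - i}" "b \<notin> {i, - i}" using ac bd unfolding isolate_def by auto
    then show "isolate i e a b"
      using crossfreeD[OF nc_relD(8)[OF assms] lt] unfolding isolate_def by blast
  qed
qed

lemma isolate_single: "single (isolate i e) i"
  unfolding single_def isolate_def by auto

lemma inner_not_single:
  assumes "nc_rel n e" "inner n e i"
  shows "\<not> single e i"
  using assms precedes_neq[of n i] nc_relD(1)[OF assms(1)] unfolding inner_def single_def signed_set_iff
  by (metis equal_neg_zero)

section \<open>Isolating an inner element is a bijection\<close>

text \<open>The chord from \<open>a'\<close> to \<open>b'\<close> passes over \<open>i\<close> and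
  ends neither in \<open>i\<close> nor in \<open>-i\<close>, so \<open>e\<close> contains it as
  well. In \<open>e\<close> it crosses the chord from \<open>a\<close> to \<open>i\<close>, unless
  \<open>a = a'\<close>.\<close>

lemma inner_isolate_common:
  assumes nc: "nc_rel n e" "nc_rel n e'" and i: "i \<in> signed_set n"
    and eq: "isolate i e = isolate i e'"
    and e: "e i a" "e i b" "precedes n a i" "precedes n i b"
    and e': "e' i a'" "e' i b'" "precedes n a' i" "precedes n i b'"
    and le: "cutpos n i a \<le> cutpos n i a'"
  shows "e i a'"
proof -
  have S: "a \<in> signed_set n" "b \<in> signed_set n" "a' \<in> signed_set n" "b' \<in> signed_set n"
    using e e' nc nc_relD(2) by blast+
  have "e' a' b'" using nc_relD(4,5)[OF nc(2)] e' by blast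
  moreover have "a' \<notin> {i, - i}" "b' \<notin> {i, - i}"
    using e'(3,4) precedes_neq precedes_neq_uminus by fastforce+
  ultimately have ab': "e a' b'" using fun_cong[OF fun_cong[OF eq, of a'], of b'] unfolding isolate_def by blast
  show ?thesis
  proof (cases "a = a'")
    case False
    then have "cutpos n i a < cutpos n i a'" using le cutpos_props(4)[OF i S(1,3)] by linarith
    moreover have "cutpos n i a' < cutpos n i i" "cutpos n i i < cutpos n i b'"
      using e'(3,4) precedes_from[OF i S(3)] precedes_from[OF i S(4)] cutpos_props(1)[OF i] by linarith+
    ultimately have "e a a'"
      using crossfreeD[OF nc_rel_cut[OF nc(1) i] _ _ _ nc_relD(4)[OF nc(1) e(1)] ab'] by blast
    then show ?thesis using nc_relD(5)[OF nc(1) e(1)] by blast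
  qed (use e in blast)
qed

text \<open>Otherwise \<open>i\<close> has companions in \<open>e'\<close> on both sides. Their
  chord is also in \<open>e\<close>, where it crosses the diameter of \<open>i\<close>, so
  \<open>a\<close> is in the zero block of \<open>e\<close>. The diameter of \<open>a\<close> then
  passes back to \<open>e'\<close> and puts \<open>i\<close> into a zero block there. Exchanging
  \<open>e\<close> and \<open>e'\<close> gives the other direction.\<close>

lemma isolate_zero_iff:
  assumes nc: "nc_rel n e" "nc_rel n e'" and i: "i \<in> signed_set n"
    and eq: "isolate i e = isolate i e'" and inn: "inner n e' i" and z: "e i (- i)"
  shows "e' i (- i)"
proof (rule ccontr)
  assume n: "\<not> e' i (- i)"
  then obtain a b where ab: "e' i a" "e' i b" "precedes n a i" "precedes n i b"
    using inn unfolding inner_def by blast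
  have S: "a \<in> signed_set n" "b \<in> signed_set n" using ab nc(2) nc_relD(2) by blast+
  have ni: "a \<notin> {i, - i}" "b \<notin> {i, - i}" "- a \<notin> {i, - i}"
    using ab(3,4) precedes_neq precedes_neq_uminus by fastforce+
  have "e' a b" using nc_relD(4,5)[OF nc(2)] ab by blast
  then have eab: "e a b" using fun_cong[OF fun_cong[OF eq, of a], of b] ni unfolding isolate_def by blast
  have "cutpos n i (- i) < cutpos n i a" "cutpos n i a < cutpos n i i" "cutpos n i i < cutpos n i b"
    using ab(3,4) precedes_from[OF i S(1)] precedes_from[OF i S(2)] cutpos_props(1)[OF i] cutpos_zero
    by fastforce+
  then have ia: "e (- i) a"
    using crossfreeD[OF nc_rel_cut[OF nc(1) i] _ _ _ nc_relD(4)[OF nc(1) z] eab] by blast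
  then have "e i (- a)" using nc_relD(6)[OF nc(1)] by force
  then have "e a (- a)" using ia z nc_relD(4,5)[OF nc(1)] by blast
  then have "e' a (- a)" using fun_cong[OF fun_cong[OF eq, of a], of "- a"] ni unfolding isolate_def by blast
  then have "e' i (- a)" "e' (- i) (- a)" using ab(1) nc_relD(5,6)[OF nc(2)] by blast+
  then show False using n nc_relD(4,5)[OF nc(2)] by blast
qed

text \<open>The block of \<open>i\<close> can be read off from the other elements. If it is the zero
  block, each companion other than \<open>-i\<close> has a diameter that survives isolation; if not,
  a companion common to both relations fixes the block.\<close>

lemma isolate_inj_le:
  assumes nc: "nc_rel n e" "nc_rel n e'" and i: "i \<in> signed_set n"
    and eq: "isolate i e = isolate i e'" and inn: "inner n e i" "inner n e' i"
    and ix: "e i x"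
  shows "e' i x"
proof (cases "e i (- i)")
  case True
  then have z: "e' i (- i)" using isolate_zero_iff[OF nc i eq inn(2)] by blast
  show ?thesis
  proof (cases "x \<in> {i, - i}")
    case True then show ?thesis using z i nc_relD(3)[OF nc(2)] by blast
  next
    case False
    have "e (- i) (- x)" using ix nc_relD(6)[OF nc(1)] by blast
    then have "e x (- x)" using ix True nc_relD(4,5)[OF nc(1)] by blast
    then have "e' x (- x)" using fun_cong[OF fun_cong[OF eq, of x], of "- x"] False
      unfolding isolate_def by force
    then show ?thesis using nc_rel_zero[OF nc(2) z] by blast
  qed
next
  case False
  then have F': "\<not> e' i (- i)" using isolate_zero_iff[OF nc(2,1) i eq[symmetric] inn(1)] by blast
  obtain a b where ab: "e i a" "e i b" "precedes n a i" "precedes n i b"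
    using False inn unfolding inner_def by blast
  obtain a' b' where ab': "e' i a'" "e' i b'" "precedes n a' i" "precedes n i b'"
    using F' inn unfolding inner_def by blast
  \<comment> \<open>Of \<open>a\<close> and \<open>a'\<close>, the one nearer to \<open>i\<close> is
    the common companion.\<close>
  have "\<exists>c. precedes n c i \<and> e i c \<and> e' i c"
  proof (cases "cutpos n i a \<le> cutpos n i a'")
    case True
    then show ?thesis using inner_isolate_common[OF nc i eq ab ab'] ab' by blast
  next
    case False
    then show ?thesis using inner_isolate_common[OF nc(2,1) i eq[symmetric] ab' ab] ab by force
  qed
  then obtain c where c: "precedes n c i" "e i c" "e' i c" by blast
  have ni: "c \<notin> {i, - i}" using c(1) precedes_neq precedes_neq_uminus by fastforce
  show ?thesis
  proof (cases "x = i")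
    case True then show ?thesis using i nc_relD(3)[OF nc(2)] by blast
  next
    case x: False
    have "e c x" using c ix nc_relD(4,5)[OF nc(1)] by blast
    moreover have "x \<noteq> - i" using ix False by blast
    ultimately have "e' c x" using fun_cong[OF fun_cong[OF eq, of c], of x] ni x unfolding isolate_def by blast
    then show ?thesis using c nc_relD(5)[OF nc(2)] by blast
  qed
qed

lemma isolate_inj:
  assumes nc: "nc_rel n e" "nc_rel n e'" and i: "i \<in> signed_set n"
    and eq: "isolate i e = isolate i e'" and inn: "inner n e i" "inner n e' i"
  shows "e = e'"
proof (intro ext)
  have row: "e i x \<longleftrightarrow> e' i x" for x
    using isolate_inj_le[OF nc i eq inn] isolate_inj_le[OF nc(2,1) i eq[symmetric] inn(2,1)] by blast
  have row': "e (- i) x \<longleftrightarrow> e' (- i) x" for x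
    using row[of "- x"] nc_relD(6)[OF nc(1)] nc_relD(6)[OF nc(2)] by (metis minus_minus)
  fix x y
  show "e x y \<longleftrightarrow> e' x y"
  proof (cases "x \<in> {i, - i} \<or> y \<in> {i, - i}")
    case True
    then show ?thesis using row row' nc_relD(4)[OF nc(1)] nc_relD(4)[OF nc(2)] by blast
  next
    case False
    then show ?thesis using fun_cong[OF fun_cong[OF eq, of x], of y] unfolding isolate_def by blast
  qed
qed

section \<open>Joining a singleton to a block: surjectivity\<close>

definition join :: "int \<Rightarrow> int \<Rightarrow> (int \<Rightarrow> int \<Rightarrow> bool) \<Rightarrow> int \<Rightarrow> int \<Rightarrow> bool" where
  "join i a e x y \<longleftrightarrow> e (if x = i then a else x) (if y = i then a else y)"

text \<open>The relation is pulled back along the map that sends \<open>i\<close> to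
  \<open>a\<close> and fixes everything else: \<open>i\<close> leaves its old class and becomes a
  twin of \<open>a\<close>.\<close>

lemma join_equiv_rel:
  assumes "equiv_rel n e" "i \<in> signed_set n" "a \<in> signed_set n"
  shows "equiv_rel n (join i a e)"
  unfolding equiv_rel_def join_def
proof (intro conjI allI ballI impI)
  fix x y z
  let ?f = "\<lambda>x. if x = i then a else x"
  show "x \<in> signed_set n" if "e (?f x) (?f y)"
    using equiv_relD(1)[OF assms(1) that] assms(2) by (cases "x = i") simp_all
  show "e (?f x) (?f x)" if "x \<in> signed_set n"
    by (rule equiv_relD(3)[OF assms(1)]) (use assms(3) that in simp)
  show "e (?f y) (?f x)" if "e (?f x) (?f y)"
    using equiv_relD(4)[OF assms(1) that] .
  show "e (?f x) (?f z)" if "e (?f x) (?f y)" "e (?f y) (?f z)"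
    using equiv_relD(5)[OF assms(1) that] .
qed

text \<open>If the gap between \<open>a\<close> and \<open>i\<close> is a union of blocks, moving \<open>i\<close> next to \<open>a\<close> makes no
  difference for crossings.\<close>

lemma join_crossfree:
  assumes e: "equiv_rel n e" and cf: "crossfree e (cutpos n i)"
    and S: "i \<in> signed_set n" "a \<in> signed_set n" and ai: "cutpos n i a < cutpos n i i"
    and gap: "\<And>x y. e x y \<Longrightarrow> cutpos n i a < cutpos n i x \<Longrightarrow> cutpos n i x < cutpos n i i \<Longrightarrow>
      cutpos n i a < cutpos n i y \<and> cutpos n i y < cutpos n i i"
  shows "crossfree (join i a e) (cutpos n i)"
proof -
  define k where "k = cutpos n i"
  note D = equiv_relD[OF e]
  note cf = cf[folded k_def] and ai = ai[folded k_def] and gap = gap[folded k_def]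
  have inj: "k x = k y \<longleftrightarrow> x = y" if "e x y' \<or> e y' x" "e y z' \<or> e z' y" for x y y' z'
    using that D(1,2) cutpos_props(4)[OF S(1)] unfolding k_def by blast
  have aa: "e a a" using D(3) S by blast
  show ?thesis
    unfolding crossfree_def k_def[symmetric]
  proof (intro allI impI, elim conjE)
    fix w x y z
    assume lt: "k w < k x" "k x < k y" "k y < k z"
      and wy: "join i a e w y" and xz: "join i a e x z"
    \<comment> \<open>Replacing \<open>i\<close> by \<open>a\<close> moves one of the four ends
      across the gap. An element tied to a partner outside the gap is not in the gap itself, so
      either the four ends still cross in \<open>e\<close>, or one of them equals
      \<open>a\<close>.\<close>
    consider "w = i" | "x = i" | "y = i" | "z = i" | "i \<notin> {w, x, y, z}" by blast
    then show "join i a e w x"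
    proof cases
      case 1
      then have "y \<noteq> i" "z \<noteq> i" "x \<noteq> i" using lt by auto
      then have "e a y" "e x z" "k a < k x" "x \<noteq> i"
        using 1 wy xz lt ai unfolding join_def by auto
      then show ?thesis using crossfreeD[OF cf _ lt(2,3)] 1 unfolding join_def by auto
    next
      case 2
      then have "w \<noteq> i" "y \<noteq> i" "z \<noteq> i" using lt by auto
      then have *: "e w y" "e a z" "w \<noteq> i" using 2 wy xz unfolding join_def by auto
      have "k w \<le> k a" using gap[OF *(1)] lt 2 by force
      then consider "k w < k a" | "w = a" using inj *(1) aa by force
      then have "e w a"
      proof cases
        case 1
        then show ?thesis using crossfreeD[OF cf _ _ _ *(1,2)] lt ai 2 by force
      qed (use aa in simp)
      then show ?thesis using 2 *(3) unfolding join_def by auto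
    next
      case 3
      then have "w \<noteq> i" "x \<noteq> i" "z \<noteq> i" using lt by auto
      then have *: "e w a" "e x z" "x \<noteq> i" "w \<noteq> i" using 3 wy xz unfolding join_def by auto
      have "k x \<le> k a" using gap[OF *(2)] lt 3 by force
      then consider "k x < k a" | "x = a" using inj *(2) aa by force
      then have "e w x"
      proof cases
        case 1
        then show ?thesis using crossfreeD[OF cf _ _ _ *(1,2)] lt ai 3 by force
      qed (use * in simp)
      then show ?thesis using *(3,4) unfolding join_def by auto
    next
      case 4
      then have "w \<noteq> i" "x \<noteq> i" "y \<noteq> i" using lt by auto
      then have *: "e w y" "e x a" "x \<noteq> i" "w \<noteq> i" using 4 wy xz unfolding join_def by auto
      \<comment> \<open>If \<open>y\<close> were in the gap, so would be its partner
        \<open>w\<close>, hence also \<open>x\<close> between them, and then the partner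
        \<open>a\<close> of \<open>x\<close>, which only bounds the gap.\<close>
      have "k y \<le> k a"
      proof (rule ccontr)
        assume "\<not> k y \<le> k a"
        then have "k a < k w" using gap[OF D(4)[OF *(1)]] lt 4 by force
        then show False using gap[OF *(2)] lt 4 by force
      qed
      then consider "k y < k a" | "y = a" using inj *(1) aa by force
      then have "e w x"
      proof cases
        case 1
        then show ?thesis using crossfreeD[OF cf _ _ _ *(1,2)] lt by force
      qed (use * D in blast)
      then show ?thesis using *(3,4) unfolding join_def by auto
    next
      case 5
      then show ?thesis using crossfreeD[OF cf lt] wy xz unfolding join_def by auto
    qed
  qed
qed

lemma single_uminus:
  assumes "nc_rel n e" "single e i"
  shows "single e (- i)"
  using assms nc_relD(6)[OF assms(1)] unfolding single_def by (metis minus_minus)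

text \<open>No block reaches across the diameter of \<open>i\<close>, so the gap for
  \<open>join_crossfree\<close> can be the whole half circle from \<open>-i\<close> to
  \<open>i\<close>. A zero block of \<open>e\<close> would reach across, so the new block of
  \<open>i\<close> and \<open>-i\<close> does not compete with another one.\<close>

lemma isolate_surj_zero:
  assumes nc: "nc_rel n e" and i: "i \<in> signed_set n" and s: "single e i"
    and none: "\<And>a b. e a b \<Longrightarrow> precedes n a i \<Longrightarrow> \<not> precedes n i b"
  shows "nc_rel n (join i (- i) e) \<and> inner n (join i (- i) e) i \<and> isolate i (join i (- i) e) = e"
proof (intro conjI)
  have s': "single e (- i)" using single_uminus[OF nc s] .
  have i0: "i \<noteq> 0" using i signed_set_iff by blast
  have sing: "e x i \<Longrightarrow> x = i" "e x (- i) \<Longrightarrow> x = - i" for x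
    using s s' nc_relD(4)[OF nc] unfolding single_def by blast+
  have ref: "e (- i) (- i)" "e i i" using i nc_relD(3)[OF nc] by simp_all
  have cf: "crossfree (join i (- i) e) (cutpos n i)"
  proof (rule join_crossfree[OF nc_relD(7)[OF nc] nc_rel_cut[OF nc i] i])
    show "- i \<in> signed_set n" "cutpos n i (- i) < cutpos n i i"
      using i i0 cutpos_zero cutpos_props(1)[OF i] signed_set_iff by auto
    fix x y
    assume xy: "e x y" and x: "cutpos n i (- i) < cutpos n i x" "cutpos n i x < cutpos n i i"
    have S: "x \<in> signed_set n" "y \<in> signed_set n" using nc_relD(1,2)[OF nc] xy by blast+
    have "precedes n x i" using x precedes_from(2)[OF i S(1)] cutpos_zero cutpos_props(1)[OF i] by simp
    then have "\<not> precedes n i y" using none xy by blast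
    moreover have "y \<noteq> i" "y \<noteq> - i" using xy x sing by auto
    ultimately have "precedes n y i" using precedes_total[OF S(2) i] by blast
    then show "cutpos n i (- i) < cutpos n i y \<and> cutpos n i y < cutpos n i i"
      using precedes_from(2)[OF i S(2)] cutpos_zero cutpos_props(1)[OF i] by simp
  qed
  have eq: "equiv_rel n (join i (- i) e)"
    using join_equiv_rel[OF nc_relD(7)[OF nc] i] i by simp
  show "nc_rel n (join i (- i) e)"
    unfolding nc_rel_def
  proof (intro conjI allI impI)
    show "crossfree (join i (- i) e) (pos n)" using crossfree_cut[OF eq i] cf by blast
    fix x y
    show "join i (- i) e x y \<Longrightarrow> join i (- i) e (- x) (- y)"
      using s s' sing ref nc_relD(6)[OF nc, of x y] i0 unfolding join_def single_def
      by (auto split: if_splits dest!: sing)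
  qed (rule eq)
  show "inner n (join i (- i) e) i"
    using ref i0 unfolding inner_def join_def by auto
  show "isolate i (join i (- i) e) = e"
    using s s' sing ref i0 unfolding join_def single_def isolate_def by (intro ext) (smt (verit) insertCI insertE empty_iff)
qed

lemma cutpos_uminus:
  assumes "i \<in> signed_set n" "x \<in> signed_set n"
  shows "cutpos n (- i) (- x) = cutpos n i x"
  using assms unfolding cutpos_def pos_def signed_set_iff by (auto split: if_splits)

text \<open>By maximality \<open>a\<close> belongs to the innermost block that spans
  \<open>i\<close>. A relation leaving the gap between \<open>a\<close> and \<open>i\<close> would
  span \<open>i\<close> from a point nearer than \<open>a\<close>, at once or after noncrossing ties
  it to the block of \<open>a\<close>. So \<open>join_crossfree\<close> applies to \<open>i\<close>
  and \<open>a\<close>, and then to the mirror images \<open>-i\<close> and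
  \<open>-a\<close>.\<close>

lemma isolate_surj_block:
  assumes nc: "nc_rel n e" and i: "i \<in> signed_set n" and s: "single e i"
    and ab: "e a b" "precedes n a i" "precedes n i b"
    and max: "\<And>x y. e x y \<Longrightarrow> precedes n x i \<Longrightarrow> precedes n i y \<Longrightarrow> cutpos n i x \<le> cutpos n i a"
  shows "\<exists>e'. nc_rel n e' \<and> inner n e' i \<and> isolate i e' = e"
proof -
  define e1 where "e1 = join i a e"
  define e2 where "e2 = join (- i) (- a) e1"
  \<comment> \<open>The combined effect of both joins: \<open>e2\<close> is the pullback of
    \<open>e\<close> along \<open>g\<close>, and it is symmetric because \<open>g\<close> commutes
    with negation.\<close>
  define g where "g x = (if x = i then a else if x = - i then - a else x)" for x
  have s': "single e (- i)" using single_uminus[OF nc s] .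
  have i0: "i \<noteq> 0" using i signed_set_iff by blast
  have sing: "e x i \<Longrightarrow> x = i" "e x (- i) \<Longrightarrow> x = - i" "e i x \<Longrightarrow> x = i" "e (- i) x \<Longrightarrow> x = - i" for x
    using s s' nc_relD(4)[OF nc] unfolding single_def by blast+
  have ref: "e (- i) (- i)" "e i i" using i nc_relD(3)[OF nc] by simp_all
  have S: "a \<in> signed_set n" "b \<in> signed_set n" using nc_relD(1,2)[OF nc] ab(1) by blast+
  have ne: "a \<noteq> i" "a \<noteq> - i" "b \<noteq> i" "b \<noteq> - i"
    using ab(2,3) precedes_neq precedes_neq_uminus by fastforce+
  have lt: "0 < cutpos n i a" "cutpos n i a < cutpos n i i" "cutpos n i i < cutpos n i b"
    using ab(2,3) precedes_from[OF i S(1)] precedes_from[OF i S(2)] cutpos_props(1)[OF i] by simp_all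
  have gap: "cutpos n i a < cutpos n i y \<and> cutpos n i y < cutpos n i i"
    if xy: "e x y" and x: "cutpos n i a < cutpos n i x" "cutpos n i x < cutpos n i i" for x y
  proof -
    have Sx: "x \<in> signed_set n" and Sy: "y \<in> signed_set n" using nc_relD(1,2)[OF nc] xy by blast+
    have px: "precedes n x i"
      using x lt precedes_from(2)[OF i Sx] cutpos_props(1)[OF i] by simp
    have no: "\<not> precedes n i z" if "e x z" for z using max[OF that px] x(1) by auto
    have nb: "\<not> e x a" using no ab nc_relD(5)[OF nc] by blast
    have "y \<noteq> i" using xy x sing(1)[of x] by auto
    moreover have "y \<noteq> - i" using xy x sing(2)[of x] lt cutpos_zero[of n i] by auto
    ultimately have py: "precedes n y i" using precedes_total[OF Sy i] no[OF xy] by blast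
    then have yi: "cutpos n i y < cutpos n i i"
      using precedes_from(2)[OF i Sy] cutpos_props(1)[OF i] by simp
    have "\<not> cutpos n i y < cutpos n i a"
    proof
      assume "cutpos n i y < cutpos n i a"
      then have "e y a"
        using crossfreeD[OF nc_rel_cut[OF nc i] _ _ _ nc_relD(4)[OF nc xy] ab(1)] x lt by force
      then show False using nb xy nc_relD(5)[OF nc] by blast
    qed
    moreover have "cutpos n i y \<noteq> cutpos n i a" using cutpos_props(4)[OF i Sy S(1)] nb xy by auto
    ultimately show ?thesis using yi by simp
  qed
  have E1: "equiv_rel n e1" unfolding e1_def by (rule join_equiv_rel[OF nc_relD(7)[OF nc] i S(1)])
  have "crossfree e1 (cutpos n i)"
    unfolding e1_def by (rule join_crossfree[OF nc_relD(7)[OF nc] nc_rel_cut[OF nc i] i S(1) lt(2) gap])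
  then have C1: "crossfree e1 (cutpos n (- i))"
    using crossfree_cut[OF E1 i] crossfree_cut[OF E1, of "- i"] i by simp
  have i': "- i \<in> signed_set n" "- a \<in> signed_set n" using i S by simp_all
  have E2: "equiv_rel n e2" unfolding e2_def by (rule join_equiv_rel[OF E1 i'])
  have "crossfree e2 (cutpos n (- i))"
    unfolding e2_def
  proof (rule join_crossfree[OF E1 C1 i'])
    show "cutpos n (- i) (- a) < cutpos n (- i) (- i)"
      using lt cutpos_uminus[OF i] i S by simp
    fix x y
    assume xy: "e1 x y" and x: "cutpos n (- i) (- a) < cutpos n (- i) x" "cutpos n (- i) x < cutpos n (- i) (- i)"
    have Sx: "x \<in> signed_set n" and Sy: "y \<in> signed_set n" using equiv_relD(1,2)[OF E1] xy by blast+
    have cu: "cutpos n (- i) (- a) = cutpos n i a" "cutpos n (- i) (- i) = cutpos n i i"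
      "cutpos n (- i) x = cutpos n i (- x)" "cutpos n (- i) y = cutpos n i (- y)"
      using cutpos_uminus[OF i S(1)] cutpos_uminus[OF i i] cutpos_uminus[OF i, of "- x"]
        cutpos_uminus[OF i, of "- y"] Sx Sy by simp_all
    have x': "cutpos n i a < cutpos n i (- x)" "cutpos n i (- x) < cutpos n i i" using x cu by simp_all
    have "x \<noteq> i" using x'(1) lt cutpos_zero[of n i] by auto
    then have xf: "e x (if y = i then a else y)" using xy unfolding e1_def join_def by simp
    show "cutpos n (- i) (- a) < cutpos n (- i) y \<and> cutpos n (- i) y < cutpos n (- i) (- i)"
    proof (cases "y = i")
      \<comment> \<open>Here \<open>i\<close> stands for \<open>a\<close>. Reflected, the relation
        would put \<open>-a\<close> into the gap before \<open>i\<close>, but \<open>-a\<close> lies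
        on the other half circle.\<close>
      case True
      then have "e (- x) (- a)" using xf nc_relD(6)[OF nc] by simp
      then have "cutpos n i (- a) < cutpos n i i" using gap x' by blast
      then show ?thesis using cutpos_props(1,3)[OF i] S(1) lt by (simp split: if_splits)
    next
      case False
      then have "e (- x) (- y)" using xf nc_relD(6)[OF nc] by simp
      then show ?thesis using gap[OF _ x'] unfolding cu by blast
    qed
  qed
  then have C2: "crossfree e2 (pos n)" using crossfree_cut[OF E2 i'(1)] by blast
  have eg: "e2 x y \<longleftrightarrow> e (g x) (g y)" for x y
    using ne i0 unfolding e2_def e1_def join_def g_def by auto
  have gm: "g (- x) = - g x" for x using i0 unfolding g_def by auto
  have "nc_rel n e2"
    unfolding nc_rel_def using E2 C2 eg gm nc_relD(6)[OF nc] by simp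
  moreover have "inner n e2 i"
  proof -
    have "e2 i a" "e2 i b" unfolding eg using ne ab(1) S nc_relD(3)[OF nc] by (simp_all add: g_def)
    then show ?thesis unfolding inner_def using ab by blast
  qed
  moreover have "isolate i e2 = e"
  proof (intro ext)
    fix x y
    show "isolate i e2 x y \<longleftrightarrow> e x y"
    proof (cases "x \<in> {i, - i} \<or> y \<in> {i, - i}")
      case True
      then have "e x y \<longleftrightarrow> x = y" using sing ref by auto
      moreover have "x = y \<Longrightarrow> e2 x y" using True equiv_relD(3)[OF E2] i by auto
      ultimately show ?thesis using True unfolding isolate_def by blast
    next
      case False
      then show ?thesis unfolding isolate_def eg by (simp add: g_def)
    qed
  qed
  ultimately show ?thesis by blast
qed

lemma finite_signed_set: "finite (signed_set n)"
  unfolding signed_set_def by simp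

lemma isolate_surj:
  assumes nc: "nc_rel n e" and i: "i \<in> signed_set n" and s: "single e i"
  shows "\<exists>e'. nc_rel n e' \<and> inner n e' i \<and> isolate i e' = e"
proof -
  define X where "X = {x. \<exists>y. e x y \<and> precedes n x i \<and> precedes n i y}"
  show ?thesis
  proof (cases "X = {}")
    case True
    then show ?thesis using isolate_surj_zero[OF nc i s] unfolding X_def by blast
  next
    case False
    have "X \<subseteq> signed_set n" using nc_relD(1)[OF nc] unfolding X_def by blast
    then have fin: "finite X" using finite_subset finite_signed_set by blast
    have "Max (cutpos n i ` X) \<in> cutpos n i ` X" using fin False by (intro Max_in) simp_all
    then obtain a where "a \<in> X" "cutpos n i a = Max (cutpos n i ` X)" by auto
    then have "a \<in> X" "\<And>x. x \<in> X \<Longrightarrow> cutpos n i x \<le> cutpos n i a" using fin by simp_all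
    then show ?thesis using isolate_surj_block[OF nc i s] unfolding X_def by blast
  qed
qed

section \<open>Free elements\<close>

definition free :: "nat \<Rightarrow> (int \<Rightarrow> int \<Rightarrow> bool) \<Rightarrow> int \<Rightarrow> bool" where
  "free n e i \<longleftrightarrow> single e i \<or> inner n e i"

text \<open>If \<open>i\<close> is what precedes \<open>j\<close> in its block, it can be replaced
  when it is isolated: a predecessor \<open>c\<close> of \<open>i\<close> works. Otherwise the chord
  from \<open>c\<close> to \<open>i\<close> would cross the chord from \<open>-j\<close> to
  \<open>-c\<close>, and the block would be its own negative.\<close>

lemma inner_block_before:
  assumes nc: "nc_rel n e" and inn: "inner n e i" and ji: "e j i" and z: "\<not> e j (- j)"
    and pr: "precedes n i j"
  shows "\<exists>c. c \<noteq> i \<and> c \<noteq> - i \<and> e j c \<and> precedes n c j"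
proof -
  note D = nc_relD[OF nc]
  have S: "i \<in> signed_set n" "j \<in> signed_set n" using D(1,2) ji by blast+
  have "\<not> e i (- i)" using z ji D(4,5,6) by blast
  then obtain c where c: "e i c" "precedes n c i" using inn unfolding inner_def by blast
  have Sc: "c \<in> signed_set n" using D(2) c by blast
  have ne: "c \<noteq> i" "c \<noteq> - i" using c(2) precedes_neq precedes_neq_uminus by fastforce+
  have jc: "e j c" using ji c D(5) by blast
  have "precedes n c j"
  proof (rule ccontr)
    assume n: "\<not> precedes n c j"
    have k: "0 < cutpos n i c" "cutpos n i c < int n" "int n < cutpos n i j" "cutpos n i j < 2 * int n"
      using precedes_from(2)[OF S(1) Sc] precedes_from(1)[OF S] c pr cutpos_props(2)[OF S] by simp_all
    moreover have "cutpos n i (- j) = cutpos n i j - int n" using k cutpos_props(3)[OF S] by simp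
    moreover have "cutpos n i (- c) = cutpos n i c + int n" using k cutpos_props(3)[OF S(1) Sc] by simp
    moreover have "cutpos n i c + int n \<noteq> cutpos n i j"
    proof
      assume "cutpos n i c + int n = cutpos n i j"
      then have "- c = j" using cutpos_props(4)[OF S(1) _ S(2), of "- c"] Sc
        \<open>cutpos n i (- c) = cutpos n i c + int n\<close> by simp
      then show False using jc z by force
    qed
    ultimately have "cutpos n i c < cutpos n i (- j)" "cutpos n i (- j) < cutpos n i i"
      "cutpos n i i < cutpos n i (- c)"
      using n cutpos_props(5)[OF S(1) Sc S(2)] cutpos_props(1)[OF S(1)] by linarith+
    then have "e c (- j)"
      using crossfreeD[OF nc_rel_cut[OF nc S(1)] _ _ _ D(4)[OF c(1)] D(6)[OF jc]] by blast
    then show False using z jc D(5) by blast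
  qed
  then show ?thesis using ne jc by blast
qed

text \<open>The mirror image: here the chord from \<open>i\<close> to \<open>c\<close> would cross
  the one from \<open>-c\<close> to \<open>-j\<close>.\<close>

lemma inner_block_after:
  assumes nc: "nc_rel n e" and inn: "inner n e i" and ji: "e j i" and z: "\<not> e j (- j)"
    and pr: "precedes n j i"
  shows "\<exists>c. c \<noteq> i \<and> c \<noteq> - i \<and> e j c \<and> precedes n j c"
proof -
  note D = nc_relD[OF nc]
  have S: "i \<in> signed_set n" "j \<in> signed_set n" using D(1,2) ji by blast+
  have "\<not> e i (- i)" using z ji D(4,5,6) by blast
  then obtain c where c: "e i c" "precedes n i c" using inn unfolding inner_def by blast
  have Sc: "c \<in> signed_set n" using D(2) c by blast
  have ne: "c \<noteq> i" "c \<noteq> - i" using c(2) precedes_neq precedes_neq_uminus by fastforce+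
  have jc: "e j c" using ji c D(5) by blast
  have "precedes n j c"
  proof (rule ccontr)
    assume n: "\<not> precedes n j c"
    have k: "int n < cutpos n i c" "cutpos n i c < 2 * int n" "0 < cutpos n i j" "cutpos n i j < int n"
      using precedes_from(1)[OF S(1) Sc] precedes_from(2)[OF S] c pr cutpos_props(2)[OF S(1) Sc] by simp_all
    moreover have mj: "cutpos n i (- j) = cutpos n i j + int n" using k cutpos_props(3)[OF S] by simp
    moreover have "cutpos n i (- c) = cutpos n i c - int n" using k cutpos_props(3)[OF S(1) Sc] by simp
    moreover have "cutpos n i j + int n \<noteq> cutpos n i c"
    proof
      assume "cutpos n i j + int n = cutpos n i c"
      then have "- j = c" using cutpos_props(4)[OF S(1) _ Sc, of "- j"] S mj by simp
      then show False using jc z by force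
    qed
    ultimately have "cutpos n i (- c) < cutpos n i i" "cutpos n i i < cutpos n i (- j)"
      "cutpos n i (- j) < cutpos n i c"
      using n cutpos_props(5)[OF S(1) S(2) Sc] cutpos_props(1)[OF S(1)] by linarith+
    then have "e (- c) i"
      using crossfreeD[OF nc_rel_cut[OF nc S(1)] _ _ _ D(4)[OF D(6)[OF jc]] c(1)] by blast
    then show False using z D(4,5) D(6)[of "- c" i] ji jc by (metis minus_minus D(6))
  qed
  then show ?thesis using ne jc by blast
qed

lemma isolate_le: "isolate i e x y \<Longrightarrow> e x y"
  unfolding isolate_def by blast

lemma isolate_keep: "e x y \<Longrightarrow> x \<notin> {i, - i} \<Longrightarrow> y \<notin> {i, - i} \<Longrightarrow> isolate i e x y"
  unfolding isolate_def by blast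

text \<open>A companion of \<open>j\<close> that gets lost is \<open>i\<close> or \<open>-i\<close>.
  As this element is inner, the nonzero block has a further element, which stays with
  \<open>j\<close>.\<close>

lemma single_isolate_imp_free:
  assumes nc: "nc_rel n e" and inn: "inner n e i" and j: "j \<in> signed_set n" "j \<noteq> i" "j \<noteq> - i"
    and s: "single (isolate i e) j"
  shows "single e j"
proof (rule ccontr)
  assume "\<not> single e j"
  then obtain x where x: "e j x" "x \<noteq> j" unfolding single_def by blast
  have no: "c = j" if "e j c" "c \<notin> {i, - i}" for c
    using s that isolate_keep[of e j c i] j(2,3) unfolding single_def by blast
  have xi: "x \<in> {i, - i}" using no x by blast
  have "j \<noteq> - j" using j(1) signed_set_iff by simp
  moreover have "- j \<notin> {i, - i}" using j by auto
  ultimately have z: "\<not> e j (- j)" using no by fastforce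
  have ix: "inner n e x" using xi inn inner_uminus[OF nc inn] by auto
  have "x \<noteq> - j" using x z by blast
  then have "precedes n x j \<or> precedes n j x"
    using precedes_total[OF nc_relD(2)[OF nc x(1)] j(1) x(2)] by blast
  then obtain c where "c \<noteq> x" "c \<noteq> - x" "e j c" "c \<noteq> j"
    using inner_block_before[OF nc ix x(1) z] inner_block_after[OF nc ix x(1) z] precedes_neq by blast
  then show False using no xi by auto
qed

text \<open>This keeps the least free index in place under toggling. Where \<open>i\<close> or
  \<open>-i\<close> witnesses that \<open>j\<close> is inner in a nonzero block,
  \<open>inner_block_before\<close> and \<open>inner_block_after\<close> supply another
  witness.\<close>

lemma free_isolate:
  assumes nc: "nc_rel n e" and inn: "inner n e i" and j: "j \<in> signed_set n" "j \<noteq> i" "j \<noteq> - i"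
  shows "free n (isolate i e) j \<longleftrightarrow> free n e j"
proof
  assume "free n (isolate i e) j"
  then show "free n e j"
    using single_isolate_imp_free[OF nc inn j] isolate_le[of i e] unfolding free_def inner_def by blast
next
  have jn: "j \<notin> {i, - i}" "- j \<notin> {i, - i}" using j by auto
  assume "free n e j"
  then consider "single e j" | "e j (- j)" | a b where "\<not> e j (- j)" "e j a" "e j b" "precedes n a j" "precedes n j b"
    unfolding free_def inner_def by blast
  then show "free n (isolate i e) j"
  proof cases
    case 1
    then show ?thesis using isolate_le[of i e] unfolding free_def single_def by blast
  next
    case 2
    then show ?thesis using isolate_keep[of e j "- j" i] jn unfolding free_def inner_def by blast
  next
    case 3
    have inx: "inner n e x" if "x \<in> {i, - i}" for x using that inn inner_uminus[OF nc inn] by auto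
    have "\<exists>a. a \<notin> {i, - i} \<and> e j a \<and> precedes n a j"
    proof (cases "a \<in> {i, - i}")
      case True
      then show ?thesis using inner_block_before[OF nc inx 3(2) 3(1) 3(4)] by auto
    qed (use 3 in blast)
    moreover have "\<exists>b. b \<notin> {i, - i} \<and> e j b \<and> precedes n j b"
    proof (cases "b \<in> {i, - i}")
      case True
      then show ?thesis using inner_block_after[OF nc inx 3(3) 3(1) 3(5)] by auto
    qed (use 3 in blast)
    ultimately show ?thesis using isolate_keep[of e j _ i] jn unfolding free_def inner_def by blast
  qed
qed

section \<open>Partitions and relations\<close>

definition sim :: "int set set \<Rightarrow> int \<Rightarrow> int \<Rightarrow> bool" where
  "sim \<pi> x y \<longleftrightarrow> (\<exists>B\<in>\<pi>. x \<in> B \<and> y \<in> B)"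

definition blocks :: "nat \<Rightarrow> (int \<Rightarrow> int \<Rightarrow> bool) \<Rightarrow> int set set" where
  "blocks n e = (\<lambda>x. {y. e x y}) ` signed_set n"

lemma signed_less_iff_pos:
  assumes "a \<in> signed_set n" "b \<in> signed_set n"
  shows "signed_less a b \<longleftrightarrow> pos n a < pos n b"
  using assms unfolding signed_less_def pos_def signed_set_iff by auto

text \<open>Blocks are disjoint, so two blocks coincide as soon as an element of one is related to
  an element of the other; this turns the condition of distinct blocks into the conclusion
  \<open>e a b\<close> of \<open>crossfree\<close>.\<close>

lemma noncrossing_sim_iff:
  assumes p: "partition_on (signed_set n) \<pi>"
  shows "noncrossing \<pi> \<longleftrightarrow> crossfree (sim \<pi>) (pos n)"
proof -
  have S: "\<And>B x. B \<in> \<pi> \<Longrightarrow> x \<in> B \<Longrightarrow> x \<in> signed_set n" using partition_onD1[OF p] by blast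
  have dis: "\<And>B C x. B \<in> \<pi> \<Longrightarrow> C \<in> \<pi> \<Longrightarrow> x \<in> B \<Longrightarrow> x \<in> C \<Longrightarrow> B = C"
    using partition_onD2[OF p] unfolding disjoint_def by blast
  show ?thesis
  proof
    assume nc: "noncrossing \<pi>"
    show "crossfree (sim \<pi>) (pos n)"
      unfolding crossfree_def
    proof (intro allI impI, elim conjE)
      fix a b c d
      assume lt: "pos n a < pos n b" "pos n b < pos n c" "pos n c < pos n d"
        and "sim \<pi> a c" "sim \<pi> b d"
      then obtain B C where BC: "B \<in> \<pi>" "a \<in> B" "c \<in> B" "C \<in> \<pi>" "b \<in> C" "d \<in> C"
        unfolding sim_def by blast
      have sl: "signed_less a b" "signed_less b c" "signed_less c d"
        using lt signed_less_iff_pos[OF S S] BC by blast+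
      have "B = C"
      proof (rule ccontr)
        assume "B \<noteq> C"
        with BC sl have "\<exists>a b c d. signed_less a b \<and> signed_less b c \<and> signed_less c d \<and>
            a \<in> B \<and> c \<in> B \<and> b \<in> C \<and> d \<in> C"
          by (intro exI[of _ a] exI[of _ b] exI[of _ c] exI[of _ d] conjI)
        with \<open>B \<noteq> C\<close> BC(1,4) have "\<exists>B\<in>\<pi>. \<exists>C\<in>\<pi>. B \<noteq> C \<and> (\<exists>a b c d. signed_less a b \<and>
            signed_less b c \<and> signed_less c d \<and> a \<in> B \<and> c \<in> B \<and> b \<in> C \<and> d \<in> C)"
          by (intro bexI[of _ B] bexI[of _ C] conjI)
        with nc show False unfolding noncrossing_def by contradiction
      qed
      then show "sim \<pi> a b" using BC unfolding sim_def by blast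
    qed
  next
    assume cf: "crossfree (sim \<pi>) (pos n)"
    show "noncrossing \<pi>"
      unfolding noncrossing_def
    proof (intro notI, elim bexE conjE exE)
      fix B C a b c d
      assume BC: "B \<in> \<pi>" "C \<in> \<pi>" "B \<noteq> C" "a \<in> B" "c \<in> B" "b \<in> C" "d \<in> C"
        and lt: "signed_less a b" "signed_less b c" "signed_less c d"
      have "pos n a < pos n b" "pos n b < pos n c" "pos n c < pos n d"
        using lt signed_less_iff_pos[OF S S] BC by blast+
      moreover have "sim \<pi> a c" "sim \<pi> b d" using BC unfolding sim_def by blast+
      ultimately have "sim \<pi> a b" using crossfreeD[OF cf] by blast
      then show False using dis BC unfolding sim_def by blast
    qed
  qed
qed

lemma sim_nc_rel:
  assumes "\<pi> \<in> NC_B n"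
  shows "nc_rel n (sim \<pi>)"
proof -
  have p: "partition_on (signed_set n) \<pi>" and m: "\<And>B. B \<in> \<pi> \<Longrightarrow> neg_block B \<in> \<pi>" and nc: "noncrossing \<pi>"
    using assms unfolding NC_B_def type_B_partition_def by auto
  have dis: "\<And>B C x. B \<in> \<pi> \<Longrightarrow> C \<in> \<pi> \<Longrightarrow> x \<in> B \<Longrightarrow> x \<in> C \<Longrightarrow> B = C"
    using partition_onD2[OF p] unfolding disjoint_def by blast
  have "equiv_rel n (sim \<pi>)"
    unfolding equiv_rel_def
  proof (intro conjI allI ballI impI)
    show "x \<in> signed_set n" if "sim \<pi> x y" for x y
      using that partition_onD1[OF p] unfolding sim_def by blast
    show "sim \<pi> x x" if "x \<in> signed_set n" for x
      using that partition_onD1[OF p] unfolding sim_def by blast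
    show "sim \<pi> y x" if "sim \<pi> x y" for x y using that unfolding sim_def by blast
    show "sim \<pi> x z" if "sim \<pi> x y" "sim \<pi> y z" for x y z using that dis unfolding sim_def by blast
  qed
  moreover have "sim \<pi> (- x) (- y)" if "sim \<pi> x y" for x y
    using that m unfolding sim_def by (meson imageI)
  ultimately show ?thesis unfolding nc_rel_def using noncrossing_sim_iff[OF p] nc by blast
qed

lemma blocks_sim:
  assumes "\<pi> \<in> NC_B n"
  shows "blocks n (sim \<pi>) = \<pi>"
proof -
  have p: "partition_on (signed_set n) \<pi>" using assms unfolding NC_B_def type_B_partition_def by auto
  have dis: "\<And>B C x. B \<in> \<pi> \<Longrightarrow> C \<in> \<pi> \<Longrightarrow> x \<in> B \<Longrightarrow> x \<in> C \<Longrightarrow> B = C"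
    using partition_onD2[OF p] unfolding disjoint_def by blast
  have cls: "{y. sim \<pi> x y} = B" if "x \<in> B" "B \<in> \<pi>" for x B
    using that dis unfolding sim_def by blast
  show ?thesis
  proof
    show "blocks n (sim \<pi>) \<subseteq> \<pi>"
      using cls partition_onD1[OF p] unfolding blocks_def by auto
    show "\<pi> \<subseteq> blocks n (sim \<pi>)"
    proof
      fix B assume B: "B \<in> \<pi>"
      then obtain x where x: "x \<in> B" using partition_onD3[OF p] by (metis ex_in_conv)
      then have "x \<in> signed_set n" using B partition_onD1[OF p] by blast
      then show "B \<in> blocks n (sim \<pi>)" using cls[OF x B] unfolding blocks_def by blast
    qed
  qed
qed

text \<open>Negation is an involution, so it preserves \<open>e\<close> in both directions. Hence a
  class is a zero block exactly when it contains a diameter, which is how the relations express zero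
  blocks.\<close>

lemma neg_block_class:
  assumes "nc_rel n e"
  shows "neg_block {y. e x y} = {y. e (- x) y}"
proof -
  have "e (- x) (- y) \<longleftrightarrow> e x y" for x y
    using nc_relD(6)[OF assms, of x y] nc_relD(6)[OF assms, of "- x" "- y"] by auto
  from this[of x] show ?thesis
    by (auto simp: image_iff) (metis minus_minus)
qed

lemma class_eq_iff:
  assumes "nc_rel n e" "x \<in> signed_set n"
  shows "{z. e x z} = {z. e y z} \<longleftrightarrow> e x y"
  using nc_relD(3,4,5)[OF assms(1)] assms(2) by blast

lemma sim_blocks:
  assumes "nc_rel n e"
  shows "sim (blocks n e) = e"
proof (intro ext)
  fix x y
  show "sim (blocks n e) x y \<longleftrightarrow> e x y"
  proof
    assume "sim (blocks n e) x y"
    then obtain z where "e z x" "e z y" unfolding sim_def blocks_def by auto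
    then show "e x y" using nc_relD(4,5)[OF assms] by blast
  next
    assume "e x y"
    then show "sim (blocks n e) x y"
      using nc_relD(1,3)[OF assms] unfolding sim_def blocks_def by (intro bexI[of _ "{z. e x z}"]) auto
  qed
qed

lemma blocks_NC_B:
  assumes nc: "nc_rel n e"
  shows "blocks n e \<in> NC_B n"
proof -
  note D = nc_relD[OF nc]
  have p: "partition_on (signed_set n) (blocks n e)"
  proof (rule partition_onI)
    show "\<Union> (blocks n e) = signed_set n" using D(2,3) unfolding blocks_def by fast
    show "disjnt p q" if "p \<in> blocks n e" "q \<in> blocks n e" "p \<noteq> q" for p q
    proof -
      obtain x y where x: "x \<in> signed_set n" "p = {z. e x z}" and y: "q = {z. e y z}"
        using \<open>p \<in> blocks n e\<close> \<open>q \<in> blocks n e\<close> unfolding blocks_def by auto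
      then have "\<not> e x y" using class_eq_iff[OF nc x(1)] \<open>p \<noteq> q\<close> by blast
      then have "\<not> (e x z \<and> e y z)" for z using D(4)[of y z] D(5)[of x z y] by blast
      then show ?thesis unfolding x y disjnt_def by blast
    qed
    show "{} \<notin> blocks n e" using D(3) unfolding blocks_def by fast
  qed
  have neg: "neg_block B \<in> blocks n e" if B: "B \<in> blocks n e" for B
  proof -
    obtain x where x: "x \<in> signed_set n" "B = {y. e x y}" using B unfolding blocks_def by blast
    then have "neg_block B = {y. e (- x) y}" using neg_block_class[OF nc] by simp
    then show ?thesis using x(1) unfolding blocks_def by (metis image_eqI signed_set_uminus)
  qed
  have zero: "B = C" if BC: "B \<in> blocks n e" "C \<in> blocks n e" "neg_block B = B" "neg_block C = C" for B C
  proof -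
    obtain x y where x: "x \<in> signed_set n" "B = {z. e x z}" and y: "y \<in> signed_set n" "C = {z. e y z}"
      using BC(1,2) unfolding blocks_def by blast
    have "e x (- x)" "e y (- y)"
      using BC(3,4) neg_block_class[OF nc, of x] neg_block_class[OF nc, of y]
        class_eq_iff[OF nc x(1), of "- x"] class_eq_iff[OF nc y(1), of "- y"] unfolding x(2) y(2) by simp_all
    then show ?thesis using nc_rel_zero[OF nc] class_eq_iff[OF nc x(1)] x(2) y(2) by blast
  qed
  have "noncrossing (blocks n e)"
    using noncrossing_sim_iff[OF p] sim_blocks[OF nc] D(8) by simp
  then show ?thesis
    unfolding NC_B_def type_B_partition_def using p neg zero by blast
qed

text \<open>Without a zero block, \<open>precedes\<close> is a tournament on each block. Elements
  that are not inner are sources or sinks, and a tournament has at most one of each.\<close>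

lemma not_free_block:
  assumes nc: "nc_rel n e" and nf: "\<And>i. i \<in> signed_set n \<Longrightarrow> \<not> free n e i" and x: "x \<in> signed_set n"
  shows "\<exists>y. y \<noteq> x \<and> {z. e x z} = {x, y}"
proof -
  note D = nc_relD[OF nc]
  have "\<not> single e x" using nf x unfolding free_def by blast
  then obtain y where y: "e x y" "y \<noteq> x" unfolding single_def by blast
  have z0: "\<not> e w (- w)" for w using nf D(1) unfolding free_def inner_def by blast
  have no: "\<not> (precedes n u v \<and> precedes n v w)" if "e x u" "e x v" "e x w" for u v w
  proof -
    have "e v u" "e v w" "v \<in> signed_set n" using that D(2,4,5) by blast+
    then show ?thesis using nf[of v] unfolding free_def inner_def by blast
  qed
  have tot: "u = v \<or> precedes n u v \<or> precedes n v u" if "e x u" "e x v" for u v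
  proof -
    have "u \<noteq> - v"
    proof
      assume "u = - v"
      moreover have "e v u" using that D(4,5) by blast
      ultimately show False using z0 by blast
    qed
    then show ?thesis using precedes_total[OF D(2)[OF that(1)] D(2)[OF that(2)]] by blast
  qed
  \<comment> \<open>among three elements of a tournament one has both a predecessor and a successor\<close>
  have "z = x \<or> z = y" if "e x z" for z
    using no tot y D(3)[OF x] that by metis
  then show ?thesis using y D(3)[OF x] by blast
qed

lemma blocks_A_B_iff:
  assumes nc: "nc_rel n e"
  shows "blocks n e \<in> A_B n \<longleftrightarrow> (\<forall>i\<in>signed_set n. \<not> free n e i)"
proof
  note D = nc_relD[OF nc]
  assume A: "blocks n e \<in> A_B n"
  show "\<forall>i\<in>signed_set n. \<not> free n e i"
  proof
    fix i assume i: "i \<in> signed_set n"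
    have B: "{y. e i y} \<in> blocks n e" using i unfolding blocks_def by blast
    have nz: "\<not> e i (- i)"
      using A B neg_block_class[OF nc, of i] class_eq_iff[OF nc i, of "- i"]
      unfolding A_B_def zero_blocks_def by fastforce
    then have "{y. e i y} \<in> nonzero_blocks (blocks n e)"
      using B neg_block_class[OF nc, of i] class_eq_iff[OF nc i, of "- i"]
      unfolding nonzero_blocks_def by fastforce
    then have "card {y. e i y} = 2" using A unfolding A_B_def by blast
    then obtain u v where uv: "{y. e i y} = {u, v}" "u \<noteq> v" by (auto simp: card_2_iff)
    then have "\<not> single e i" unfolding single_def by blast
    moreover have "\<not> (precedes n a i \<and> precedes n i b)" if "e i a" "e i b" for a b
    proof
      assume pr: "precedes n a i \<and> precedes n i b"
      have "a \<noteq> i" "b \<noteq> i" using pr precedes_neq by blast+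
      moreover have "a \<in> {u, v}" "b \<in> {u, v}" "i \<in> {u, v}"
        using that D(3)[OF i] unfolding uv(1)[symmetric] by simp_all
      \<comment> \<open>In a block of two elements both witnesses are the partner of
        \<open>i\<close>, which cannot both precede and follow \<open>i\<close>.\<close>
      ultimately have "a = b" by auto
      then show False using pr unfolding precedes_def by auto
    qed
    ultimately show "\<not> free n e i" using nz unfolding free_def inner_def by blast
  qed
next
  assume nf: "\<forall>i\<in>signed_set n. \<not> free n e i"
  have nz: "\<not> e i (- i)" if "i \<in> signed_set n" for i using nf that unfolding free_def inner_def by blast
  have "neg_block B \<noteq> B" if "B \<in> blocks n e" for B
  proof -
    obtain x where x: "x \<in> signed_set n" "B = {y. e x y}" 
      using \<open>B \<in> blocks n e\<close> unfolding blocks_def by blast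
    show ?thesis
      using nz[OF x(1)] neg_block_class[OF nc, of x] class_eq_iff[OF nc x(1), of "- x"] x(2) by simp
  qed
  moreover have "card B = 2" if "B \<in> blocks n e" for B
  proof -
    obtain x where "x \<in> signed_set n" "B = {y. e x y}" using \<open>B \<in> blocks n e\<close> unfolding blocks_def by blast
    then obtain y where "y \<noteq> x" "B = {x, y}" using not_free_block[OF nc, of x] nf by blast
    then show ?thesis by simp
  qed
  ultimately show "blocks n e \<in> A_B n"
    using blocks_NC_B[OF nc] unfolding A_B_def zero_blocks_def nonzero_blocks_def by blast
qed

section \<open>Counting pairs of nonzero blocks\<close>

definition class_pair :: "(int \<Rightarrow> int \<Rightarrow> bool) \<Rightarrow> int \<Rightarrow> int set set" where
  "class_pair e x = {{y. e x y}, {y. e (- x) y}}"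

text \<open>Indexing the pairs by elements makes it possible to compare \<open>e\<close> and
  \<open>isolate i e\<close> over a common index set.\<close>

lemma nonzero_block_pairs_blocks:
  assumes nc: "nc_rel n e"
  shows "nonzero_block_pairs (blocks n e) = class_pair e ` {x \<in> signed_set n. \<not> e x (- x)}"
proof -
  have "neg_block {y. e x y} \<noteq> {y. e x y} \<longleftrightarrow> \<not> e x (- x)" if "x \<in> signed_set n" for x
    using neg_block_class[OF nc, of x] class_eq_iff[OF nc that, of "- x"] by auto
  then have "nonzero_blocks (blocks n e) = (\<lambda>x. {y. e x y}) ` {x \<in> signed_set n. \<not> e x (- x)}"
    unfolding nonzero_blocks_def blocks_def by (auto)
  then show ?thesis
    unfolding nonzero_block_pairs_def class_pair_def by (simp add: image_image neg_block_class[OF nc])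
qed

lemma class_pair_eq:
  assumes nc: "nc_rel n e" and "e x y \<or> e (- x) y"
  shows "class_pair e x = class_pair e y"
proof -
  have eq: "class_pair e u = class_pair e v" if uv: "e u v" for u v
  proof -
    have "{z. e u z} = {z. e v z}" "{z. e (- u) z} = {z. e (- v) z}"
      using class_eq_iff[OF nc] nc_relD(1)[OF nc] uv nc_relD(6)[OF nc uv] by blast+
    then show ?thesis unfolding class_pair_def by simp
  qed
  have "class_pair e (- x) = class_pair e x" unfolding class_pair_def by (simp add: insert_commute)
  then show ?thesis using assms(2) eq by metis
qed

text \<open>A nonzero block that contains \<open>i\<close> or \<open>-i\<close> has an element
  besides them, so trimming empties no nonzero block, and the two singletons form the one new pair.
  If \<open>i\<close> is in the zero block, that block only shrinks or vanishes, which the count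
  does not see.\<close>

lemma card_pairs_isolate:
  assumes nc: "nc_rel n e" and inn: "inner n e i" and i: "i \<in> signed_set n"
  shows "card (nonzero_block_pairs (blocks n (isolate i e))) = Suc (card (nonzero_block_pairs (blocks n e)))"
proof -
  note D = nc_relD[OF nc]
  \<comment> \<open>\<open>Q\<close> indexes the pairs of \<open>e\<close> and also the old pairs
    after isolation; \<open>h\<close> trims the blocks of a pair.\<close>
  define Q where "Q = {x \<in> signed_set n. x \<notin> {i, - i} \<and> \<not> e x (- x)}"
  define h :: "int set set \<Rightarrow> int set set" where "h = image (\<lambda>B. B - {i, - i})"
  have i0: "i \<noteq> 0" using i signed_set_iff by blast
  have nc': "nc_rel n (isolate i e)" by (rule isolate_nc_rel[OF nc])
  have Qneg: "- x \<notin> {i, - i}" "x \<notin> {i, - i}" "x \<in> signed_set n" "\<not> e x (- x)" if "x \<in> Q" for x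
    using that unfolding Q_def by auto
  have P: "nonzero_block_pairs (blocks n e) = class_pair e ` Q"
    unfolding nonzero_block_pairs_blocks[OF nc]
  proof
    show "class_pair e ` Q \<subseteq> class_pair e ` {x \<in> signed_set n. \<not> e x (- x)}" unfolding Q_def by blast
    show "class_pair e ` {x \<in> signed_set n. \<not> e x (- x)} \<subseteq> class_pair e ` Q"
    proof (rule image_subsetI)
      fix x assume x: "x \<in> {x \<in> signed_set n. \<not> e x (- x)}"
      show "class_pair e x \<in> class_pair e ` Q"
      proof (cases "x \<in> {i, - i}")
        \<comment> \<open>Being inner in a nonzero block, \<open>x\<close> has a companion in
          \<open>Q\<close> that represents the same pair.\<close>
        case True
        then have "inner n e x" using inn inner_uminus[OF nc inn] by auto
        then obtain a where a: "e x a" "precedes n a x" using x unfolding inner_def by blast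
        then have "a \<notin> {i, - i}" using True precedes_neq[OF a(2)] precedes_neq_uminus[OF a(2)] by auto
        moreover have "\<not> e a (- a)" using x a D(4,5,6) by blast
        ultimately have "a \<in> Q" using D(2)[OF a(1)] unfolding Q_def by blast
        then show ?thesis using class_pair_eq[OF nc, of x a] a by blast
      qed (use x Q_def in blast)
    qed
  qed
  have cls: "{y. isolate i e x y} = {y. e x y} - {i, - i}" if "x \<notin> {i, - i}" for x
    using that unfolding isolate_def by auto
  have hp: "class_pair (isolate i e) x = h (class_pair e x)" if "x \<in> Q" for x
    using cls[of x] cls[of "- x"] Qneg[OF that] unfolding class_pair_def h_def by simp
  have si: "{y. isolate i e i y} = {i}" "{y. isolate i e (- i) y} = {- i}"
    using i D(3)[OF i] D(3)[of "- i"] unfolding isolate_def by auto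
  have "{x \<in> signed_set n. \<not> isolate i e x (- x)} = Q \<union> {i, - i}"
    using i i0 unfolding Q_def isolate_def signed_set_iff by auto
  then have "nonzero_block_pairs (blocks n (isolate i e)) = class_pair (isolate i e) ` (Q \<union> {i, - i})"
    using nonzero_block_pairs_blocks[OF nc'] by simp
  also have "\<dots> = insert {{i}, {- i}} (class_pair (isolate i e) ` Q)"
    using si unfolding class_pair_def by auto
  also have "class_pair (isolate i e) ` Q = h ` class_pair e ` Q"
    using hp by (simp add: image_image)
  finally have P': "nonzero_block_pairs (blocks n (isolate i e)) = insert {{i}, {- i}} (h ` class_pair e ` Q)" .
  have mem: "x \<in> {y. e x y} - {i, - i}" if "x \<in> Q" for x using Qneg[OF that] D(3) by blast
  \<comment> \<open>An element of \<open>Q\<close> survives in its trimmed class, so the trimmed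
    pair still reveals the original one.\<close>
  have "inj_on h (class_pair e ` Q)"
  proof (rule inj_onI, elim imageE, simp only:)
    fix x y assume xy: "x \<in> Q" "y \<in> Q" "h (class_pair e x) = h (class_pair e y)"
    have "{z. e x z} - {i, - i} \<in> h (class_pair e y)"
      unfolding xy(3)[symmetric] unfolding h_def class_pair_def by blast
    then have "e y x \<or> e (- y) x" using mem[OF xy(1)] unfolding h_def class_pair_def by blast
    then show "class_pair e x = class_pair e y" using class_pair_eq[OF nc, of y x] by simp
  qed
  moreover have "{{i}, {- i}} \<notin> h ` class_pair e ` Q"
    unfolding h_def class_pair_def by auto
  moreover have "finite Q" using finite_signed_set unfolding Q_def by simp
  ultimately show ?thesis unfolding P P' by (simp add: card_image)
qed

section \<open>The involution\<close>

text \<open>By \<open>isolate_inj\<close> and \<open>isolate_surj\<close> a relation in which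
  \<open>i\<close> is single has exactly one preimage in the given set, so \<open>inv_into\<close>
  is a genuine inverse here.\<close>

definition toggle :: "nat \<Rightarrow> int \<Rightarrow> (int \<Rightarrow> int \<Rightarrow> bool) \<Rightarrow> int \<Rightarrow> int \<Rightarrow> bool" where
  "toggle n i e = (if single e i then inv_into {e'. nc_rel n e' \<and> inner n e' i} (isolate i) e else isolate i e)"

lemma toggle_props:
  assumes nc: "nc_rel n e" and i: "i \<in> signed_set n" and f: "free n e i"
  shows "nc_rel n (toggle n i e)" and "free n (toggle n i e) i" and "toggle n i (toggle n i e) = e"
    and "even (card (nonzero_block_pairs (blocks n (toggle n i e)))) \<longleftrightarrow>
      odd (card (nonzero_block_pairs (blocks n e)))"
    and "\<And>j. j \<in> signed_set n \<Longrightarrow> j \<noteq> i \<Longrightarrow> j \<noteq> - i \<Longrightarrow> free n (toggle n i e) j \<longleftrightarrow> free n e j"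
proof -
  define I where "I = {e'. nc_rel n e' \<and> inner n e' i}"
  have inj: "inj_on (isolate i) I"
    using isolate_inj[OF _ _ i] unfolding I_def by (intro inj_onI) blast
  \<comment> \<open>Of \<open>e\<close> and its toggle, \<open>a\<close> is the one in which
    \<open>i\<close> is inner and \<open>b\<close> the one in which it is single, so each claim
    needs only the facts on \<open>isolate\<close>.\<close>
  obtain a b where ab: "a \<in> I" "b = isolate i a" "e = a \<and> toggle n i e = b \<or> e = b \<and> toggle n i e = a"
    "toggle n i a = b" "toggle n i b = a"
  proof (cases "single e i")
    case True
    obtain a where "nc_rel n a \<and> inner n a i \<and> isolate i a = e"
      using isolate_surj[OF nc i True] ..
    then have a: "a \<in> I" "isolate i a = e" unfolding I_def by simp_all
    have "toggle n i e = a"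
      using inv_into_f_f[OF inj a(1)] a(2) True unfolding toggle_def I_def[symmetric] by simp
    moreover have "toggle n i a = e"
      using a inner_not_single unfolding toggle_def I_def by auto
    ultimately show ?thesis using a by (intro that[of a e]) simp_all
  next
    case False
    then have "e \<in> I" using f nc unfolding free_def I_def by blast
    moreover have "toggle n i e = isolate i e" using False unfolding toggle_def by simp
    moreover have "toggle n i (isolate i e) = e"
      using inv_into_f_f[OF inj \<open>e \<in> I\<close>] isolate_single[of i e] unfolding toggle_def I_def[symmetric] by simp
    ultimately show ?thesis by (intro that[of e "isolate i e"]) simp_all
  qed
  have a: "nc_rel n a" "inner n a i" using ab(1) unfolding I_def by blast+
  have b: "nc_rel n b" "single b i" using isolate_nc_rel[OF a(1)] isolate_single ab(2) by simp_all
  show "nc_rel n (toggle n i e)" using ab(3) a b by auto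
  show "free n (toggle n i e) i" using ab(3) a b unfolding free_def by auto
  show "toggle n i (toggle n i e) = e" using ab by auto
  show "even (card (nonzero_block_pairs (blocks n (toggle n i e)))) \<longleftrightarrow>
      odd (card (nonzero_block_pairs (blocks n e)))"
    using ab(3) card_pairs_isolate[OF a i] unfolding ab(2) by auto
  show "free n (toggle n i e) j \<longleftrightarrow> free n e j" if "j \<in> signed_set n" "j \<noteq> i" "j \<noteq> - i" for j
    using ab(3) free_isolate[OF a that] unfolding ab(2) by auto
qed

text \<open>Positive indices suffice, because freeness is invariant under negation; outside
  \<open>A_B n\<close> the minimum exists.\<close>

definition first_free :: "nat \<Rightarrow> (int \<Rightarrow> int \<Rightarrow> bool) \<Rightarrow> nat" where
  "first_free n e = (LEAST k. 1 \<le> k \<and> k \<le> n \<and> free n e (int k))"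

lemma toggle_first_free:
  assumes nc: "nc_rel n e" and nA: "blocks n e \<notin> A_B n"
  defines "e' \<equiv> toggle n (int (first_free n e)) e"
  shows "nc_rel n e'" and "blocks n e' \<notin> A_B n" and "toggle n (int (first_free n e')) e' = e"
    and "even (card (nonzero_block_pairs (blocks n e'))) \<longleftrightarrow> odd (card (nonzero_block_pairs (blocks n e)))"
proof -
  let ?P = "\<lambda>k. 1 \<le> k \<and> k \<le> n \<and> free n e (int k)"
  define k where "k = first_free n e"
  obtain i where i: "i \<in> signed_set n" "free n e i" using nA blocks_A_B_iff[OF nc] by blast
  have "free n e (- i)"
    using i(2) single_uminus[OF nc] inner_uminus[OF nc] unfolding free_def by blast
  then have "?P (nat \<bar>i\<bar>)" using i signed_set_iff[of i n] by (cases "i < 0") auto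
  then have k: "?P k" unfolding k_def first_free_def by (rule LeastI)
  have kS: "int j \<in> signed_set n" if "1 \<le> j" "j \<le> n" for j using that signed_set_iff by simp
  have ks: "int k \<in> signed_set n" and kf: "free n e (int k)" using k kS by blast+
  note T = toggle_props[OF nc ks kf, folded e'_def[folded k_def]]
  show "nc_rel n e'" by (rule T)
  show "blocks n e' \<notin> A_B n" using blocks_A_B_iff[OF T(1)] T(2) ks by blast
  show "even (card (nonzero_block_pairs (blocks n e'))) \<longleftrightarrow> odd (card (nonzero_block_pairs (blocks n e)))"
    by (rule T)
  \<comment> \<open>Toggling at \<open>k\<close> leaves \<open>k\<close> free and does not affect
    the freeness of any other positive index, so the second application undoes the first.\<close>
  have "first_free n e' = k"
    unfolding first_free_def
  proof (rule Least_equality)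
    show "1 \<le> k \<and> k \<le> n \<and> free n e' (int k)" using k T(2) by blast
    fix j assume j: "1 \<le> j \<and> j \<le> n \<and> free n e' (int j)"
    show "k \<le> j"
    proof (cases "j = k")
      case False
      then have "free n e (int j)" using j T(5)[of "int j"] kS by simp
      then show ?thesis unfolding k_def first_free_def using j by (intro Least_le) blast
    qed simp
  qed
  then show "toggle n (int (first_free n e')) e' = e" using T(3) by simp
qed

theorem theorem2p4:
  fixes n :: nat
  shows "\<exists>\<rho> :: int set set \<Rightarrow> int set set.
    (\<forall>\<pi> \<in> NC_B n - A_B n. \<rho> \<pi> \<in> NC_B n - A_B n) \<and>
    (\<forall>\<pi> \<in> NC_B n - A_B n. \<rho> (\<rho> \<pi>) = \<pi>) \<and>
    (\<forall>\<pi> \<in> NC_B n - A_B n.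
       even (card (nonzero_block_pairs (\<rho> \<pi>))) \<longleftrightarrow> odd (card (nonzero_block_pairs \<pi>)))"
proof -
  define F where "F e = toggle n (int (first_free n e)) e" for e
  \<comment> \<open>\<open>sim\<close> and \<open>blocks\<close> are mutually inverse between
    \<open>NC_B n\<close> and the relations with \<open>nc_rel n\<close>, so \<rho> inherits the
    properties of \<open>F\<close>.\<close>
  define \<rho> where "\<rho> \<pi> = blocks n (F (sim \<pi>))" for \<pi>
  show ?thesis
  proof (intro exI[of _ \<rho>] conjI ballI)
    fix \<pi> assume pi: "\<pi> \<in> NC_B n - A_B n"
    then have nc: "nc_rel n (sim \<pi>)" and bl: "blocks n (sim \<pi>) = \<pi>"
      using sim_nc_rel blocks_sim by blast+
    note T = toggle_first_free[OF nc, unfolded bl, folded F_def]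
    have nA: "\<pi> \<notin> A_B n" using pi by blast
    show "\<rho> \<pi> \<in> NC_B n - A_B n" using T(1,2)[OF nA] blocks_NC_B unfolding \<rho>_def by blast
    show "\<rho> (\<rho> \<pi>) = \<pi>" using T(3)[OF nA] sim_blocks[OF T(1)[OF nA]] bl unfolding \<rho>_def by simp
    show "even (card (nonzero_block_pairs (\<rho> \<pi>))) \<longleftrightarrow> odd (card (nonzero_block_pairs \<pi>))"
      using T(4)[OF nA] unfolding \<rho>_def .
  qed
qed

end
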